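(* Let $H=(\Gamma,D,G,R,F)$ be a hybrid system with a forward-invariant point $z^*\in\bigsqcup_{v\in V}D_v$. Suppose there exist constants $c>0$ and $\lambda\in(0,1)$, class $\mathcal K$ functions $\underline\alpha_1,\overline\alpha_1,\underline\alpha_2,\overline\alpha_2$, and maps $V_c,V_d\colon\bigsqcup_{v\in V}D_v\to\mathbb R_{\ge0}$ with $V_c$ continuously differentiable, which are positive definite with respect to $z^*$: $$\underline\alpha_1(\|x\|_{z^*})\le V_c(x)\le\overline\alpha_1(\|x\|_{z^*}),\qquad\underline\alpha_2(\|x\|_{z^*})\le V_d(x)\le\overline\alpha_2(\|x\|_{z^*}),$$ and which satisfy the flow condition, for all $v\in V$ and $x\in D_v$, $$\frac{dV_c}{dt}(x)\cdot f_v(x)\le-c,$$ and the jump conditions, for all $e\in E$ and $x\in G_e$, $$V_c(x)=0,\qquad V_d(R_e(x))\le\lambda V_d(x),\qquad V_c(R_e(x))\le V_d(x).$$ Then $z^*$ is stable.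
   Context: Hybrid system $H=(\Gamma,D,G,R,F)$: $\Gamma=(V,E)$ is a directed graph with source and target maps $s,t\colon E\to V$; $D=\{D_v\}_{v\in V}$ are smooth manifolds (possibly with boundary); $G=\{G_e\}_{e\in E}$ are guards $G_e\subseteq D_{s(e)}$; $R=\{R_e\}_{e\in E}$ are smooth reset maps $R_e\colon G_e\to D_{t(e)}$; $F=\{f_v\}_{v\in V}$ are vector fields $f_v$ on $D_v$. Guards of edges with a common source are assumed disjoint. An execution (solution) $\chi=(\Lambda,I,\rho,C)$ consists of an index set $\Lambda$ ($\mathbb N$ or $\{0,\dots,n-1\}$), intervals $I_j=[\tau_j,\tau_{j+1}]$, a map $\rho\colon\Lambda\to V$ and trajectories $c_j\colon I_j\to D_{\rho(j)}$ with $\frac{d}{dt}c_j(t)=f_{\rho(j)}(c_j(t))$ and, for $j,j+1\in\Lambda$ and $e=(\rho(j),\rho(j+1))\in E$, $c_j(\tau_{j+1})\in G_e$ and $c_{j+1}(\tau_{j+1})=R_e(c_j(\tau_{j+1}))$. A point $z^*$ is forward invariant if every execution starting at $z^*$ remains at $z^*$. $\|x\|_{z^*}:=d(x,z^* )$, where $d$ is a given semi-metric on $\bigsqcup_vD_v$: $d(x,y)\ge0$, with $d(x,y)=0$ iff $x=y$. A class $\mathcal K$ function is a smooth strictly increasing $\alpha\colon\mathbb R_{\ge0}\to\mathbb R_{\ge0}$ with $\alpha(0)=0$ having an order-preserving (smooth) inverse $\mathbb R_{\ge0}\to\mathbb R_{\ge0}$. The expression $\frac{dV_c}{dt}(x)\cdot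 f_v(x)$ is the derivative of $V_c$ along $f_v$ at $x$. $z^*$ is stable if there is a class $\mathcal K$ function $\alpha$ such that every execution satisfies $\|c_j(t)\|_{z^*}\le\alpha(\|c_0(\tau_0)\|_{z^*})$ for all $j\in\Lambda$, $t\in I_j$. *)

theory Defs
  imports
    "HOL-Analysis.Analysis"
    "HOL-Library.Extended_Nat"
    "Graph_Theory.Digraph"
begin

section \<open>Differentiability in coordinates\<close>

text \<open>
  The dimension of the manifolds below varies with the vertex of a graph, so it must be a
  number and not a type.  Hence coordinates live in the library's \<open>Euclidean_space n\<close>, whose
  points are the \<open>x :: nat \<Rightarrow> real\<close> with \<open>x i = 0\<close> for all \<open>i \<ge> n\<close>.
\<close>

text \<open>
  The partial derivative is taken along the slice of \<open>S\<close> through \<open>x\<close>.  It is the usual one when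
  \<open>S\<close> is open, and one-sided where \<open>x\<close> is a boundary point of a relatively open subset \<open>S\<close> of a
  half-space (and \<open>i\<close> is the transversal direction).
\<close>
definition partial_deriv ::
  "(nat \<Rightarrow> real) set \<Rightarrow> nat \<Rightarrow> ((nat \<Rightarrow> real) \<Rightarrow> real) \<Rightarrow> (nat \<Rightarrow> real) \<Rightarrow> real" where
  "partial_deriv S i f x =
     vector_derivative (\<lambda>h. f (x(i := h))) (at (x i) within {h. x(i := h) \<in> S})"

primrec Ck_open :: "nat \<Rightarrow> nat \<Rightarrow> (nat \<Rightarrow> real) set \<Rightarrow> ((nat \<Rightarrow> real) \<Rightarrow> real) \<Rightarrow> bool" where
  "Ck_open n 0 U f \<longleftrightarrow> continuous_map (subtopology (Euclidean_space n) U) euclideanreal f"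
| "Ck_open n (Suc k) U f \<longleftrightarrow>
     continuous_map (subtopology (Euclidean_space n) U) euclideanreal f \<and>
     (\<forall>i<n. (\<forall>x\<in>U. (\<lambda>h. f (x(i := h))) differentiable (at (x i) within {h. x(i := h) \<in> U})) \<and>
            Ck_open n k U (partial_deriv U i f))"

text \<open>
  Class \<open>C\<^sup>k\<close>, \<open>k \<le> \<infinity>\<close>, on an arbitrary subset \<open>S\<close> of \<open>\<real>\<^sup>n\<close>: locally the restriction of a \<open>C\<^sup>k\<close>
  function on an open set.
\<close>
definition Ck_on :: "nat \<Rightarrow> enat \<Rightarrow> (nat \<Rightarrow> real) set \<Rightarrow> ((nat \<Rightarrow> real) \<Rightarrow> real) \<Rightarrow> bool" where
  "Ck_on n k S f \<longleftrightarrow>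
     (\<forall>x\<in>S. \<exists>U g. openin (Euclidean_space n) U \<and> x \<in> U \<and>
        (\<forall>j. enat j \<le> k \<longrightarrow> Ck_open n j U g) \<and> (\<forall>y\<in>S \<inter> U. g y = f y))"

section \<open>Smooth manifolds with boundary\<close>

text \<open>A chart is a coordinate domain together with a coordinate map.\<close>

type_synonym 'p chart = "'p set \<times> ('p \<Rightarrow> nat \<Rightarrow> real)"

text \<open>The atlas need not be maximal.\<close>

record 'p mfd =
  mtop :: "'p topology"
  mdim :: nat
  atlas :: "'p chart set"

abbreviation carr :: "'p mfd \<Rightarrow> 'p set" where
  "carr M \<equiv> topspace (mtop M)"

definition chart_inv :: "'p chart \<Rightarrow> (nat \<Rightarrow> real) \<Rightarrow> 'p" where
  "chart_inv \<kappa> = inv_into (fst \<kappa>) (snd \<kappa>)"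

text \<open>For \<open>n = 0\<close> the condition is void, since then \<open>x 0 = 0\<close>.\<close>

definition half_space :: "nat \<Rightarrow> (nat \<Rightarrow> real) set" where
  "half_space n = {x \<in> topspace (Euclidean_space n). 0 \<le> x 0}"

definition is_chart :: "'p topology \<Rightarrow> nat \<Rightarrow> 'p chart \<Rightarrow> bool" where
  "is_chart X n \<kappa> \<longleftrightarrow>
     openin X (fst \<kappa>) \<and>
     openin (subtopology (Euclidean_space n) (half_space n)) (snd \<kappa> ` fst \<kappa>) \<and>
     homeomorphic_map (subtopology X (fst \<kappa>))
       (subtopology (Euclidean_space n) (snd \<kappa> ` fst \<kappa>)) (snd \<kappa>)"

definition smooth_manifold :: "'p mfd \<Rightarrow> bool" where
  "smooth_manifold M \<longleftrightarrow>
     Hausdorff_space (mtop M) \<and> second_countable (mtop M) \<and>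
     (\<forall>\<kappa>\<in>atlas M. is_chart (mtop M) (mdim M) \<kappa>) \<and>
     carr M = (\<Union>\<kappa>\<in>atlas M. fst \<kappa>) \<and>
     (\<forall>\<kappa>\<in>atlas M. \<forall>\<kappa>'\<in>atlas M. \<forall>i<mdim M.
        Ck_on (mdim M) \<infinity> (snd \<kappa> ` (fst \<kappa> \<inter> fst \<kappa>')) (\<lambda>x. snd \<kappa>' (chart_inv \<kappa> x) i))"

definition smooth_map_on :: "'p mfd \<Rightarrow> 'p mfd \<Rightarrow> 'p set \<Rightarrow> ('p \<Rightarrow> 'p) \<Rightarrow> bool" where
  "smooth_map_on M N A r \<longleftrightarrow>
     continuous_map (subtopology (mtop M) A) (mtop N) r \<and>
     (\<forall>\<kappa>\<in>atlas M. \<forall>\<kappa>'\<in>atlas N. \<forall>i<mdim N.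
        Ck_on (mdim M) \<infinity> (snd \<kappa> ` {p \<in> fst \<kappa> \<inter> A. r p \<in> fst \<kappa>'})
          (\<lambda>x. snd \<kappa>' (r (chart_inv \<kappa> x)) i))"

definition C1_function :: "'p mfd \<Rightarrow> ('p \<Rightarrow> real) \<Rightarrow> bool" where
  "C1_function M V \<longleftrightarrow>
     (\<forall>\<kappa>\<in>atlas M. Ck_on (mdim M) 1 (snd \<kappa> ` fst \<kappa>) (\<lambda>x. V (chart_inv \<kappa> x)))"

text \<open>
  A tangent vector at \<open>p\<close> is given by its components \<open>X p \<kappa> i\<close>, \<open>i < mdim M\<close>, in all charts
  \<open>\<kappa>\<close> around \<open>p\<close>, subject to the transformation law.  No continuity in \<open>p\<close> is required.
\<close>

type_synonym 'p vfield = "'p \<Rightarrow> 'p chart \<Rightarrow> nat \<Rightarrow> real"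

definition vector_field :: "'p mfd \<Rightarrow> 'p vfield \<Rightarrow> bool" where
  "vector_field M X \<longleftrightarrow>
     (\<forall>\<kappa>\<in>atlas M. \<forall>\<kappa>'\<in>atlas M. \<forall>p\<in>fst \<kappa> \<inter> fst \<kappa>'. \<forall>i<mdim M.
        X p \<kappa>' i =
          (\<Sum>j<mdim M. partial_deriv (snd \<kappa> ` (fst \<kappa> \<inter> fst \<kappa>')) j
             (\<lambda>x. snd \<kappa>' (chart_inv \<kappa> x) i) (snd \<kappa> p) * X p \<kappa> j))"

text \<open>
  The derivative of \<open>V\<close> along \<open>X\<close> at \<open>p\<close>.  By the chain rule it does not depend on the chart if
  \<open>V\<close> is \<open>C\<^sup>1\<close> and \<open>X\<close> is a vector field.
\<close>
definition lie_deriv :: "'p mfd \<Rightarrow> 'p vfield \<Rightarrow> ('p \<Rightarrow> real) \<Rightarrow> 'p \<Rightarrow> real" where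
  "lie_deriv M X V p =
     (let \<kappa> = (SOME \<kappa>. \<kappa> \<in> atlas M \<and> p \<in> fst \<kappa>)
      in \<Sum>i<mdim M. partial_deriv (snd \<kappa> ` fst \<kappa>) i (\<lambda>x. V (chart_inv \<kappa> x)) (snd \<kappa> p) * X p \<kappa> i)"

text \<open>
  Derivatives at the end points of the time interval are one-sided.  If \<open>a = b\<close>, the
  differential equation is void.
\<close>
definition integral_curve ::
  "'p mfd \<Rightarrow> 'p vfield \<Rightarrow> real \<Rightarrow> real \<Rightarrow> (real \<Rightarrow> 'p) \<Rightarrow> bool" where
  "integral_curve M X a b c \<longleftrightarrow>
     continuous_map (top_of_set {a..b}) (mtop M) c \<and>
     (\<forall>t\<in>{a..b}. \<forall>\<kappa>\<in>atlas M. c t \<in> fst \<kappa> \<longrightarrow>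
        (\<forall>i<mdim M. ((\<lambda>u. snd \<kappa> (c u) i) has_real_derivative X (c t) \<kappa> i) (at t within {a..b})))"

section \<open>Hybrid systems\<close>

record ('v, 'e, 'p) hybrid_data =
  hgraph :: "('v, 'e) pre_digraph"
  hdom :: "'v \<Rightarrow> 'p mfd"
  guard :: "'e \<Rightarrow> 'p set"
  reset :: "'e \<Rightarrow> 'p \<Rightarrow> 'p"
  hfield :: "'v \<Rightarrow> 'p vfield"

abbreviation hverts :: "('v, 'e, 'p) hybrid_data \<Rightarrow> 'v set" where
  "hverts H \<equiv> verts (hgraph H)"
abbreviation hedges :: "('v, 'e, 'p) hybrid_data \<Rightarrow> 'e set" where
  "hedges H \<equiv> arcs (hgraph H)"
abbreviation src :: "('v, 'e, 'p) hybrid_data \<Rightarrow> 'e \<Rightarrow> 'v" where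
  "src H \<equiv> tail (hgraph H)"
abbreviation tgt :: "('v, 'e, 'p) hybrid_data \<Rightarrow> 'e \<Rightarrow> 'v" where
  "tgt H \<equiv> head (hgraph H)"

definition hybrid_system :: "('v, 'e, 'p) hybrid_data \<Rightarrow> bool" where
  "hybrid_system H \<longleftrightarrow>
     wf_digraph (hgraph H) \<and>
     (\<forall>v\<in>hverts H. smooth_manifold (hdom H v) \<and> vector_field (hdom H v) (hfield H v)) \<and>
     (\<forall>e\<in>hedges H. guard H e \<subseteq> carr (hdom H (src H e)) \<and>
        smooth_map_on (hdom H (src H e)) (hdom H (tgt H e)) (guard H e) (reset H e)) \<and>
     (\<forall>e\<in>hedges H. \<forall>e'\<in>hedges H. e \<noteq> e' \<and> src H e = src H e' \<longrightarrow> guard H e \<inter> guard H e' = {})"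

text \<open>The disjoint union of the domains.\<close>

definition points :: "('v, 'e, 'p) hybrid_data \<Rightarrow> ('v \<times> 'p) set" where
  "points H = Sigma (hverts H) (\<lambda>v. carr (hdom H v))"

record ('v, 'p) exec =
  idx :: "nat set"
  tau :: "nat \<Rightarrow> real"
  rho :: "nat \<Rightarrow> 'v"
  traj :: "nat \<Rightarrow> real \<Rightarrow> 'p"

abbreviation ival :: "('v, 'p) exec \<Rightarrow> nat \<Rightarrow> real set" where
  "ival \<xi> j \<equiv> {tau \<xi> j..tau \<xi> (Suc j)}"

definition state :: "('v, 'p) exec \<Rightarrow> nat \<Rightarrow> real \<Rightarrow> 'v \<times> 'p" where
  "state \<xi> j t = (rho \<xi> j, traj \<xi> j t)"

abbreviation start :: "('v, 'p) exec \<Rightarrow> 'v \<times> 'p" where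
  "start \<xi> \<equiv> state \<xi> 0 (tau \<xi> 0)"

definition execution :: "('v, 'e, 'p) hybrid_data \<Rightarrow> ('v, 'p) exec \<Rightarrow> bool" where
  "execution H \<xi> \<longleftrightarrow>
     (idx \<xi> = UNIV \<or> (\<exists>n\<ge>1. idx \<xi> = {..<n})) \<and>
     (\<forall>j\<in>idx \<xi>. tau \<xi> j \<le> tau \<xi> (Suc j) \<and> rho \<xi> j \<in> hverts H \<and>
        integral_curve (hdom H (rho \<xi> j)) (hfield H (rho \<xi> j))
          (tau \<xi> j) (tau \<xi> (Suc j)) (traj \<xi> j)) \<and>
     (\<forall>j. j \<in> idx \<xi> \<and> Suc j \<in> idx \<xi> \<longrightarrow>
        (\<exists>e\<in>hedges H. src H e = rho \<xi> j \<and> tgt H e = rho \<xi> (Suc j) \<and>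
           traj \<xi> j (tau \<xi> (Suc j)) \<in> guard H e \<and>
           traj \<xi> (Suc j) (tau \<xi> (Suc j)) = reset H e (traj \<xi> j (tau \<xi> (Suc j)))))"

definition forward_invariant :: "('v, 'e, 'p) hybrid_data \<Rightarrow> 'v \<times> 'p \<Rightarrow> bool" where
  "forward_invariant H z \<longleftrightarrow>
     (\<forall>\<xi>. execution H \<xi> \<and> start \<xi> = z \<longrightarrow> (\<forall>j\<in>idx \<xi>. \<forall>t\<in>ival \<xi> j. state \<xi> j t = z))"

section \<open>Comparison functions and stability\<close>

text \<open>Neither symmetry nor compatibility with the topology is required.\<close>

definition semi_metric_on :: "'a set \<Rightarrow> ('a \<Rightarrow> 'a \<Rightarrow> real) \<Rightarrow> bool" where
  "semi_metric_on S d \<longleftrightarrow> (\<forall>x\<in>S. \<forall>y\<in>S. 0 \<le> d x y \<and> (d x y = 0 \<longleftrightarrow> x = y))"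

text \<open>Derivatives of all orders exist on \<open>[0, \<infinity>)\<close>, one-sided at \<open>0\<close>.\<close>

definition smooth_nonneg :: "(real \<Rightarrow> real) \<Rightarrow> bool" where
  "smooth_nonneg f \<longleftrightarrow>
     (\<exists>D. (\<forall>x\<ge>0. D 0 x = f x) \<and>
          (\<forall>k::nat. \<forall>x\<ge>0. (D k has_real_derivative D (Suc k) x) (at x within {0..})))"

definition class_K :: "(real \<Rightarrow> real) \<Rightarrow> bool" where
  "class_K \<alpha> \<longleftrightarrow>
     \<alpha> ` {0..} \<subseteq> {0..} \<and> \<alpha> 0 = 0 \<and> strict_mono_on {0..} \<alpha> \<and> smooth_nonneg \<alpha> \<and>
     (\<exists>\<beta>. \<beta> ` {0..} \<subseteq> {0..} \<and> (\<forall>x\<ge>0. \<beta> (\<alpha> x) = x \<and> \<alpha> (\<beta> x) = x) \<and>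
          strict_mono_on {0..} \<beta> \<and> smooth_nonneg \<beta>)"

definition stable_point ::
  "('v, 'e, 'p) hybrid_data \<Rightarrow> ('v \<times> 'p \<Rightarrow> 'v \<times> 'p \<Rightarrow> real) \<Rightarrow> 'v \<times> 'p \<Rightarrow> bool" where
  "stable_point H d z \<longleftrightarrow>
     (\<exists>\<alpha>. class_K \<alpha> \<and>
        (\<forall>\<xi>. execution H \<xi> \<longrightarrow>
           (\<forall>j\<in>idx \<xi>. \<forall>t\<in>ival \<xi> j. d (state \<xi> j t) z \<le> \<alpha> (d (start \<xi>) z))))"

end

theory Submission
  imports Defs
begin

text \<open>
  A guard point \<open>x\<close> satisfies \<open>Vc x = 0\<close>, and \<open>Vc\<close> is positive definite, so \<open>x = z\<close>: an
  execution can jump only at \<open>z\<close>.  There \<open>Vd\<close> vanishes as well, hence \<open>Vc \<le> Vd z \<le> 0\<close>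
  immediately after the jump.  Between jumps \<open>Vc\<close> does not increase, because its derivative
  along the flow is at most \<open>- c < 0\<close>.  So \<open>Vc\<close> never exceeds its initial value along an
  execution, and the two comparison functions for \<open>Vc\<close> turn this into
  \<open>a1 (d x z) \<le> b1 (d x\<^sub>0 z)\<close> for every state \<open>x\<close> reached from \<open>x\<^sub>0\<close>.  The function witnessing
  stability is the composition of the inverse of \<open>a1\<close> with \<open>b1\<close>.

  Two ingredients carry analytic content.  The class of comparison functions is closed under
  composition and inverses (\<open>class_K_compose\<close>, \<open>class_K_inverse\<close>), where smoothness of a
  composition on the closed half-line has to be shown.  And the decrease of \<open>Vc\<close> along a
  trajectory rests on a chain rule (\<open>has_derivative_along_integral_curve\<close>): \<open>C\<^sup>1\<close> is given
  through continuous partial derivatives of local extensions in charts, whereas the derivative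
  along the vector field is formed from one-sided partial derivatives at boundary points, so
  both must be identified.
\<close>

section \<open>Composition of comparison functions\<close>

text \<open>
  A recursive form of \<open>k\<close>-fold differentiability on \<open>[0, \<infinity>)\<close>.  Unlike the sequence of
  derivatives in the definition of smoothness, it permits closure under products and composition
  to be proved by induction on \<open>k\<close>, without a formula for higher derivatives of a composition.
\<close>
primrec Dk_nonneg :: "nat \<Rightarrow> (real \<Rightarrow> real) \<Rightarrow> bool" where
  "Dk_nonneg 0 f \<longleftrightarrow> True"
| "Dk_nonneg (Suc k) f \<longleftrightarrow>
     (\<exists>f'. (\<forall>x\<ge>0. (f has_real_derivative f' x) (at x within {0..})) \<and> Dk_nonneg k f')"

lemma Dk_nonneg_cong:
  assumes "Dk_nonneg k f" and "\<And>x. x \<ge> 0 \<Longrightarrow> f x = g x"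
  shows "Dk_nonneg k g"
proof (cases k)
  case (Suc m)
  then obtain f' where f': "\<And>x. x \<ge> 0 \<Longrightarrow> (f has_real_derivative f' x) (at x within {0..})"
      "Dk_nonneg m f'"
    using assms(1) by auto
  have "(g has_real_derivative f' x) (at x within {0..})" if "x \<ge> 0" for x
    using that assms(2) by (intro has_field_derivative_transform_within[OF f'(1), of _ 1]) auto
  then show ?thesis using Suc f'(2) by auto
qed simp

lemma Dk_nonneg_Suc_imp: "Dk_nonneg (Suc k) f \<Longrightarrow> Dk_nonneg k f"
  by (induction k arbitrary: f) auto

lemma Dk_nonneg_add:
  "Dk_nonneg k f \<Longrightarrow> Dk_nonneg k g \<Longrightarrow> Dk_nonneg k (\<lambda>x. f x + g x)"
proof (induction k arbitrary: f g)
  case (Suc k)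
  obtain f' where f': "\<And>x. x \<ge> 0 \<Longrightarrow> (f has_real_derivative f' x) (at x within {0..})"
      "Dk_nonneg k f'"
    using Suc.prems(1) by auto
  obtain g' where g': "\<And>x. x \<ge> 0 \<Longrightarrow> (g has_real_derivative g' x) (at x within {0..})"
      "Dk_nonneg k g'"
    using Suc.prems(2) by auto
  show ?case
    using f'(1) g'(1) Suc.IH[OF f'(2) g'(2)]
    by (auto intro!: exI[of _ "\<lambda>x. f' x + g' x"] DERIV_add)
qed simp

lemma Dk_nonneg_mult:
  "Dk_nonneg k f \<Longrightarrow> Dk_nonneg k g \<Longrightarrow> Dk_nonneg k (\<lambda>x. f x * g x)"
proof (induction k arbitrary: f g)
  case (Suc k)
  obtain f' where f': "\<And>x. x \<ge> 0 \<Longrightarrow> (f has_real_derivative f' x) (at x within {0..})"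
      "Dk_nonneg k f'"
    using Suc.prems(1) by auto
  obtain g' where g': "\<And>x. x \<ge> 0 \<Longrightarrow> (g has_real_derivative g' x) (at x within {0..})"
      "Dk_nonneg k g'"
    using Suc.prems(2) by auto
  have "Dk_nonneg k (\<lambda>x. f' x * g x + g' x * f x)"
    by (intro Dk_nonneg_add Suc.IH f'(2) g'(2) Dk_nonneg_Suc_imp[OF Suc.prems(1)]
        Dk_nonneg_Suc_imp[OF Suc.prems(2)])
  then show ?case
    using f'(1) g'(1)
    by (auto intro!: exI[of _ "\<lambda>x. f' x * g x + g' x * f x"] DERIV_mult)
qed simp

text \<open>
  The derivative \<open>f' (g x) * g' x\<close> contains the original \<open>g\<close>, which is why \<open>g\<close> stays fixed in
  the induction while \<open>f\<close> varies.
\<close>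
lemma Dk_nonneg_compose:
  assumes "g ` {0..} \<subseteq> {0..}"
  shows "Dk_nonneg k f \<Longrightarrow> Dk_nonneg k g \<Longrightarrow> Dk_nonneg k (\<lambda>x. f (g x))"
proof (induction k arbitrary: f)
  case (Suc k)
  obtain f' where f': "\<And>x. x \<ge> 0 \<Longrightarrow> (f has_real_derivative f' x) (at x within {0..})"
      "Dk_nonneg k f'"
    using Suc.prems(1) by auto
  obtain g' where g': "\<And>x. x \<ge> 0 \<Longrightarrow> (g has_real_derivative g' x) (at x within {0..})"
      "Dk_nonneg k g'"
    using Suc.prems(2) by auto
  have "((\<lambda>x. f (g x)) has_real_derivative f' (g x) * g' x) (at x within {0..})"
    if "x \<ge> 0" for x
  proof -
    have "(f has_real_derivative f' (g x)) (at (g x) within g ` {0..})"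
      using that assms by (intro DERIV_subset[OF f'(1)]) auto
    from DERIV_image_chain[OF this g'(1)[OF that]] show ?thesis by (simp add: o_def)
  qed
  moreover have "Dk_nonneg k (\<lambda>x. f' (g x) * g' x)"
    using Suc.IH[OF f'(2) Dk_nonneg_Suc_imp[OF Suc.prems(2)]] g'(2) by (rule Dk_nonneg_mult)
  ultimately show ?case
    by (simp only: Dk_nonneg.simps) (intro exI[of _ "\<lambda>x. f' (g x) * g' x"] conjI allI impI)
qed simp

lemma smooth_nonneg_iff_Dk: "smooth_nonneg f \<longleftrightarrow> (\<forall>k. Dk_nonneg k f)"
proof
  assume "smooth_nonneg f"
  then obtain D where D: "\<And>x. x \<ge> 0 \<Longrightarrow> D 0 x = f x"
    "\<And>k x. x \<ge> 0 \<Longrightarrow> (D k has_real_derivative D (Suc k) x) (at x within {0..})"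
    unfolding smooth_nonneg_def by auto
  have "Dk_nonneg k (D m)" for k m
    by (induction k arbitrary: m) (use D(2) in auto)
  from Dk_nonneg_cong[OF this D(1)] show "\<forall>k. Dk_nonneg k f" by blast
next
  assume f: "\<forall>k. Dk_nonneg k f"
  define S where "S g g' \<longleftrightarrow> (\<forall>x\<ge>0. (g has_real_derivative g' x) (at x within {0..})) \<and>
    (\<forall>k. Dk_nonneg k g')" for g g' :: "real \<Rightarrow> real"
  (* Derivatives on [0, oo) are unique there, so one derivative serves all orders k at once. *)
  have step: "\<exists>g'. S g g'" if g: "\<forall>k. Dk_nonneg k g" for g
  proof -
    obtain g' where g': "\<And>x. x \<ge> 0 \<Longrightarrow> (g has_real_derivative g' x) (at x within {0..})"
      using g[rule_format, of "Suc 0"] by auto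
    have "Dk_nonneg k g'" for k
    proof -
      obtain h where h: "\<And>x. x \<ge> 0 \<Longrightarrow> (g has_real_derivative h x) (at x within {0..})"
          "Dk_nonneg k h"
        using g[rule_format, of "Suc k"] by auto
      have "h x = g' x" if x: "x \<ge> 0" for x
      proof (rule has_field_derivative_unique[OF h(1)[OF x] g'[OF x]])
        have "at x within {x..x+1} \<noteq> bot"
          by (simp add: at_within_Icc_at_right trivial_limit_at_right_real)
        moreover have "at x within {x..x+1} \<le> at x within {0..}"
          using x by (intro at_le) auto
        ultimately show "at x within {0..} \<noteq> bot"
          using le_bot by metis
      qed
      with h(2) show ?thesis by (rule Dk_nonneg_cong)
    qed
    with g' show ?thesis unfolding S_def by blast
  qed
  define D where "D = rec_nat f (\<lambda>_ g. SOME g'. S g g')"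
  have D0: "D 0 = f" and DS: "D (Suc k) = (SOME g'. S (D k) g')" for k
    by (simp_all add: D_def)
  have smooth_D: "\<forall>m. Dk_nonneg m (D k)" for k
  proof (induction k)
    case (Suc k)
    then show ?case using someI_ex[OF step[OF Suc]] by (simp add: DS S_def)
  qed (use f D0 in simp)
  have "S (D k) (D (Suc k))" for k
    unfolding DS by (rule someI_ex[OF step[OF smooth_D]])
  then show "smooth_nonneg f"
    unfolding smooth_nonneg_def S_def using D0 by blast
qed

lemma smooth_nonneg_compose:
  assumes "smooth_nonneg f" "smooth_nonneg g" "g ` {0..} \<subseteq> {0..}"
  shows "smooth_nonneg (\<lambda>x. f (g x))"
  using assms Dk_nonneg_compose by (auto simp: smooth_nonneg_iff_Dk)

lemma class_K_compose:
  assumes "class_K f" "class_K g"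
  shows "class_K (\<lambda>x. f (g x))"
proof -
  obtain f' where f': "f' ` {0..} \<subseteq> {0..}" "\<And>x. x \<ge> 0 \<Longrightarrow> f' (f x) = x \<and> f (f' x) = x"
    "strict_mono_on {0..} f'" "smooth_nonneg f'"
    using assms(1) unfolding class_K_def by auto
  obtain g' where g': "g' ` {0..} \<subseteq> {0..}" "\<And>x. x \<ge> 0 \<Longrightarrow> g' (g x) = x \<and> g (g' x) = x"
    "strict_mono_on {0..} g'" "smooth_nonneg g'"
    using assms(2) unfolding class_K_def by auto
  have f: "f ` {0..} \<subseteq> {0..}" "f 0 = 0" "strict_mono_on {0..} f" "smooth_nonneg f"
    and g: "g ` {0..} \<subseteq> {0..}" "g 0 = 0" "strict_mono_on {0..} g" "smooth_nonneg g"
    using assms unfolding class_K_def by auto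
  have mono: "strict_mono_on {0..} (\<lambda>x. p (q x))"
    if "strict_mono_on {0..} p" "strict_mono_on {0..} q" "q ` {0..} \<subseteq> {0..}"
    for p q :: "real \<Rightarrow> real"
    using that by (auto simp: strict_mono_on_def image_subset_iff)
  show ?thesis
    unfolding class_K_def
  proof (intro conjI exI[of _ "\<lambda>x. g' (f' x)"] allI impI)
    show "smooth_nonneg (\<lambda>x. f (g x))" "smooth_nonneg (\<lambda>x. g' (f' x))"
      using f g f' g' by (auto intro: smooth_nonneg_compose)
  qed (use f g f' g' mono in \<open>auto simp: image_subset_iff\<close>)
qed

lemma class_K_inverse:
  assumes "class_K f"
  obtains f' where "class_K f'" "\<And>x. x \<ge> 0 \<Longrightarrow> f' (f x) = x"
proof -
  obtain f' where f': "f' ` {0..} \<subseteq> {0..}" "\<And>x. x \<ge> 0 \<Longrightarrow> f' (f x) = x \<and> f (f' x) = x"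
    "strict_mono_on {0..} f'" "smooth_nonneg f'"
    using assms unfolding class_K_def by auto
  moreover have "f' 0 = 0"
    using f'(2)[of 0] assms unfolding class_K_def by auto
  ultimately have "class_K f'"
    using assms unfolding class_K_def by (auto intro!: exI[of _ f])
  with f'(2) that show ?thesis by auto
qed

lemma class_K_mono:
  assumes "class_K f" "0 \<le> x" "x \<le> y"
  shows "f x \<le> f y"
  using assms unfolding class_K_def
  by (cases "x = y") (auto simp: strict_mono_on_def intro: less_imp_le)

text \<open>
  This makes guard points collapse onto \<open>z\<close>: there the lower bound for \<open>Vc\<close> is nonpositive.
\<close>
lemma class_K_nonpos_imp_zero:
  assumes "class_K f" "0 \<le> x" "f x \<le> 0"
  shows "x = 0"
proof (rule ccontr)
  assume "x \<noteq> 0"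
  moreover have "strict_mono_on {0..} f" using assms(1) unfolding class_K_def by simp
  ultimately have "f 0 < f x"
    using assms(2) by (intro strict_mono_onD[of "{0..}" f]) auto
  then show False using assms unfolding class_K_def by auto
qed

section \<open>The chain rule in coordinates\<close>

text \<open>
  The topology is a product topology, so a neighbourhood constrains finitely many coordinates;
  those beyond \<open>n\<close> vanish identically.  Boxes suit the chain rule because they contain, with a
  point, every point obtained by replacing some of its coordinates by those of the centre.
\<close>
lemma openin_Euclidean_space_box:
  assumes "openin (Euclidean_space n) U" "x \<in> U"
  obtains r where "r > 0"
    "\<And>y. y \<in> topspace (Euclidean_space n) \<Longrightarrow> (\<And>i. i < n \<Longrightarrow> \<bar>y i - x i\<bar> < r) \<Longrightarrow> y \<in> U"
proof -
  obtain T where T: "openin (powertop_real UNIV) T"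
      "U = T \<inter> {x. \<forall>i\<ge>n. x i = (0::real)}"
    using assms(1) unfolding Euclidean_space_def openin_subtopology by auto
  have "x \<in> T" using T assms(2) by simp
  then obtain F where F: "\<And>i. openin euclideanreal (F i)" "x \<in> PiE UNIV F" "PiE UNIV F \<subseteq> T"
    using T(1) unfolding openin_product_topology_alt by fastforce
  have "\<exists>e>0. ball (x i) e \<subseteq> F i" for i
    using F(1)[of i] F(2) by (simp add: open_contains_ball PiE_iff)
  then obtain e where e: "\<And>i. e i > 0" "\<And>i. ball (x i) (e i) \<subseteq> F i" by metis
  define r where "r = Min (insert 1 (e ` {..<n}))"
  show ?thesis
  proof
    show "r > 0" using e(1) by (simp add: r_def)
    fix y assume y: "y \<in> topspace (Euclidean_space n)" "\<And>i. i < n \<Longrightarrow> \<bar>y i - x i\<bar> < r"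
    have "y i \<in> F i" for i
    proof (cases "i < n")
      case True
      then have "r \<le> e i" by (auto simp: r_def)
      with y(2)[OF True] have "y i \<in> ball (x i) (e i)"
        by (simp add: dist_real_def abs_minus_commute)
      then show ?thesis using e(2) by blast
    next
      case False
      then have "y i = x i"
        using y(1) T(2) assms(2) by (simp add: topspace_Euclidean_space)
      then show ?thesis using F(2) by (simp add: PiE_iff)
    qed
    then have "y \<in> T" using F(3) by (auto simp: PiE_iff)
    then show "y \<in> U" using T(2) y(1) by (simp add: topspace_Euclidean_space)
  qed
qed

lemma continuous_at_Euclidean_space_box:
  assumes U: "openin (Euclidean_space n) U" "x \<in> U"
    and f: "continuous_map (subtopology (Euclidean_space n) U) euclideanreal f" and "\<epsilon> > 0"
  obtains r where "r > 0"
    "\<And>y. y \<in> topspace (Euclidean_space n) \<Longrightarrow> (\<And>i. i < n \<Longrightarrow> \<bar>y i - x i\<bar> < r) \<Longrightarrow>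
       y \<in> U \<and> \<bar>f y - f x\<bar> < \<epsilon>"
proof -
  define W where "W = {y \<in> topspace (subtopology (Euclidean_space n) U). f y \<in> ball (f x) \<epsilon>}"
  have "openin (subtopology (Euclidean_space n) U) W"
    unfolding W_def by (rule openin_continuous_map_preimage[OF f]) simp
  then have W: "openin (Euclidean_space n) W"
    using U(1) by (simp add: openin_open_subtopology)
  have "x \<in> W" using U \<open>\<epsilon> > 0\<close> openin_subset[OF U(1)] by (auto simp: W_def)
  from openin_Euclidean_space_box[OF W this] obtain r where "r > 0"
    "\<And>y. y \<in> topspace (Euclidean_space n) \<Longrightarrow> (\<And>i. i < n \<Longrightarrow> \<bar>y i - x i\<bar> < r) \<Longrightarrow> y \<in> W"
    by blast
  with that show ?thesis by (fastforce simp: W_def dist_real_def abs_minus_commute)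
qed

lemma partial_deriv_works:
  assumes "Ck_open n (Suc 0) U g" "y \<in> U" "i < n"
  shows "((\<lambda>h. g (y(i := h))) has_real_derivative partial_deriv U i g y)
           (at (y i) within {h. y(i := h) \<in> U})"
  using assms unfolding partial_deriv_def
  by (auto simp: vector_derivative_works has_real_derivative_iff_has_vector_derivative)

text \<open>
  The mean value inequality for \<open>h \<mapsto> g (w(i := h)) - L * h\<close>, whose derivative is at most \<open>\<epsilon>\<close> in
  absolute value.
\<close>
lemma increment_by_partial_deriv:
  assumes g: "Ck_open n (Suc 0) U g" and i: "i < n"
    and bd: "\<And>h. \<bar>h - s\<bar> < r \<Longrightarrow> w(i := h) \<in> U \<and> \<bar>partial_deriv U i g (w(i := h)) - L\<bar> \<le> \<epsilon>"
    and h: "\<bar>h - s\<bar> < r"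
  shows "\<bar>g (w(i := h)) - g (w(i := s)) - L * (h - s)\<bar> \<le> \<epsilon> * \<bar>h - s\<bar>"
proof -
  have ball: "h' \<in> ball s r \<longleftrightarrow> \<bar>h' - s\<bar> < r" for h'
    by (simp add: dist_real_def abs_minus_commute)
  have "((\<lambda>h. g (w(i := h)) - L * h) has_real_derivative partial_deriv U i g (w(i := h')) - L)
          (at h' within ball s r)" if "h' \<in> ball s r" for h'
  proof -
    have "((\<lambda>h. g (w(i := h))) has_real_derivative partial_deriv U i g (w(i := h')))
            (at h' within {h. w(i := h) \<in> U})"
      using partial_deriv_works[OF g, of "w(i := h')" i] bd[of h'] that i ball by simp
    then have "((\<lambda>h. g (w(i := h))) has_real_derivative partial_deriv U i g (w(i := h')))
            (at h' within ball s r)"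
      by (rule DERIV_subset) (use bd ball in auto)
    then show ?thesis by (auto intro!: derivative_eq_intros)
  qed
  from field_differentiable_bound[OF convex_ball this, of \<epsilon> h s]
  have "norm (g (w(i := h)) - L * h - (g (w(i := s)) - L * s)) \<le> \<epsilon> * norm (h - s)"
    using bd h ball by fastforce
  then show ?thesis by (simp add: algebra_simps)
qed

text \<open>
  The increment of \<open>g\<close> between \<open>x = \<gamma> t\<close> and \<open>y\<close> is split into steps that change one coordinate
  at a time, from \<open>x\<close> to \<open>y\<close>.  This writes \<open>g y - g x\<close> as \<open>\<Sum>k<n. q k y * (y k - x k)\<close> with
  difference quotients \<open>q k\<close>, which tend to the partial derivatives at \<open>x\<close> by their continuity.
  Dividing by \<open>u - t\<close> at \<open>y = \<gamma> u\<close> and passing to the limit gives the chain rule.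
\<close>
lemma chain_rule_Ck_open:
  fixes \<gamma> :: "real \<Rightarrow> nat \<Rightarrow> real"
  assumes U: "openin (Euclidean_space n) U" and g: "Ck_open n (Suc 0) U g"
    and t: "\<gamma> t \<in> U"
    and top: "\<forall>\<^sub>F u in at t within S. \<gamma> u \<in> topspace (Euclidean_space n)"
    and \<gamma>: "\<And>i. i < n \<Longrightarrow> ((\<lambda>u. \<gamma> u i) has_real_derivative v i) (at t within S)"
  shows "((\<lambda>u. g (\<gamma> u)) has_real_derivative (\<Sum>i<n. partial_deriv U i g (\<gamma> t) * v i))
           (at t within S)"
proof -
  define x where "x = \<gamma> t"
  (* m k y agrees with y in the first k coordinates and with x in the others.  The value of q at
     y k = x k is its limit, so that q k tends to it even if the curve keeps its k-th coordinate. *)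
  define m where "m k y i = (if i < k then y i else x i)" for k y and i :: nat
  define q where "q k y = (if y k = x k then partial_deriv U k g x
      else (g (m (Suc k) y) - g (m k y)) / (y k - x k))" for k y
  have x_top: "x \<in> topspace (Euclidean_space n)" using t openin_subset[OF U] by (auto simp: x_def)
  have m_Suc: "m (Suc k) y = (m k y)(k := y k)" and m_k: "(m k y)(k := x k) = m k y" for k y
    by (auto simp: m_def fun_eq_iff less_Suc_eq)
  have telescope: "g y - g x = (\<Sum>k<n. q k y * (y k - x k))"
    if "y \<in> topspace (Euclidean_space n)" for y
  proof -
    have "m n y = y" "m 0 y = x"
      using that x_top by (auto simp: m_def fun_eq_iff topspace_Euclidean_space)
    then have "g y - g x = (\<Sum>k<n. g (m (Suc k) y) - g (m k y))"
      using sum_lessThan_telescope[of "\<lambda>k. g (m k y)" n] by simp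
    also have "\<dots> = (\<Sum>k<n. q k y * (y k - x k))"
    proof (rule sum.cong[OF refl])
      fix k
      show "g (m (Suc k) y) - g (m k y) = q k y * (y k - x k)"
      proof (cases "y k = x k")
        case True
        then have "m (Suc k) y = m k y" using m_k[of k y] by (simp add: m_Suc)
        then show ?thesis using True by simp
      qed (simp add: q_def)
    qed
    finally show ?thesis .
  qed
  have q_lim: "((\<lambda>u. q k (\<gamma> u)) \<longlongrightarrow> partial_deriv U k g x) (at t within S)" if k: "k < n" for k
  proof (rule tendstoI)
    fix \<epsilon> :: real assume "\<epsilon> > 0"
    have cont: "continuous_map (subtopology (Euclidean_space n) U) euclideanreal (partial_deriv U k g)"
      using g k by simp
    obtain r where r: "r > 0" "\<And>y. y \<in> topspace (Euclidean_space n) \<Longrightarrow>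
        (\<And>i. i < n \<Longrightarrow> \<bar>y i - x i\<bar> < r) \<Longrightarrow>
        y \<in> U \<and> \<bar>partial_deriv U k g y - partial_deriv U k g x\<bar> < \<epsilon>/2"
      using continuous_at_Euclidean_space_box[OF U _ cont, of x "\<epsilon>/2"] t \<open>\<epsilon> > 0\<close>
      unfolding x_def by auto
    have "\<forall>\<^sub>F u in at t within S. \<forall>i\<in>{..<n}. \<bar>\<gamma> u i - x i\<bar> < r"
    proof (rule eventually_ball_finite)
      show "\<forall>i\<in>{..<n}. \<forall>\<^sub>F u in at t within S. \<bar>\<gamma> u i - x i\<bar> < r"
      proof
        fix i assume "i \<in> {..<n}"
        then have "((\<lambda>u. \<gamma> u i) \<longlongrightarrow> x i) (at t within S)"
          using DERIV_continuous[OF \<gamma>[of i]] by (simp add: continuous_within x_def)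
        from tendstoD[OF this \<open>r > 0\<close>]
        show "\<forall>\<^sub>F u in at t within S. \<bar>\<gamma> u i - x i\<bar> < r" by (simp add: dist_real_def)
      qed
    qed simp
    with top show "\<forall>\<^sub>F u in at t within S. dist (q k (\<gamma> u)) (partial_deriv U k g x) < \<epsilon>"
    proof eventually_elim
      fix u assume y: "\<gamma> u \<in> topspace (Euclidean_space n)" "\<forall>i\<in>{..<n}. \<bar>\<gamma> u i - x i\<bar> < r"
      define y where "y = \<gamma> u"
      show "dist (q k (\<gamma> u)) (partial_deriv U k g x) < \<epsilon>"
      proof (cases "y k = x k")
        case False
        have box: "(m k y)(k := h) \<in> U \<and>
            \<bar>partial_deriv U k g ((m k y)(k := h)) - partial_deriv U k g x\<bar> \<le> \<epsilon>/2"
          if "\<bar>h - x k\<bar> < r" for h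
        proof -
          have "(m k y)(k := h) \<in> topspace (Euclidean_space n)"
            using k x_top y(1) by (auto simp: topspace_Euclidean_space m_def y_def)
          moreover have "\<bar>((m k y)(k := h)) i - x i\<bar> < r" if "i < n" for i
            using that y(2) \<open>\<bar>h - x k\<bar> < r\<close> r(1) by (auto simp: m_def y_def)
          ultimately show ?thesis using r(2) by fastforce
        qed
        have "\<bar>g ((m k y)(k := y k)) - g ((m k y)(k := x k)) - partial_deriv U k g x * (y k - x k)\<bar>
            \<le> \<epsilon>/2 * \<bar>y k - x k\<bar>"
          using y(2) k by (intro increment_by_partial_deriv[OF g k box]) (auto simp: y_def)
        moreover have "g ((m k y)(k := y k)) - g ((m k y)(k := x k)) = q k y * (y k - x k)"
          using False by (simp add: q_def m_Suc m_k)
        ultimately have "\<bar>q k y - partial_deriv U k g x\<bar> * \<bar>y k - x k\<bar> \<le> \<epsilon>/2 * \<bar>y k - x k\<bar>"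
          by (simp add: abs_mult[symmetric] left_diff_distrib)
        then have "\<bar>q k y - partial_deriv U k g x\<bar> \<le> \<epsilon>/2"
          using False by simp
        then show ?thesis using \<open>\<epsilon> > 0\<close> by (simp add: dist_real_def y_def)
      qed (use \<open>\<epsilon> > 0\<close> in \<open>simp add: q_def y_def\<close>)
    qed
  qed
  have "((\<lambda>u. \<Sum>k<n. q k (\<gamma> u) * ((\<gamma> u k - \<gamma> t k) / (u - t))) \<longlongrightarrow>
      (\<Sum>k<n. partial_deriv U k g x * v k)) (at t within S)"
    using \<gamma> q_lim by (intro tendsto_sum tendsto_mult) (auto simp: has_field_derivative_iff)
  moreover have "\<forall>\<^sub>F u in at t within S. (\<Sum>k<n. q k (\<gamma> u) * ((\<gamma> u k - \<gamma> t k) / (u - t))) =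
      (g (\<gamma> u) - g (\<gamma> t)) / (u - t)"
    using top
    by eventually_elim (use telescope in \<open>simp add: x_def sum_divide_distrib\<close>)
  ultimately show ?thesis
    unfolding has_field_derivative_iff x_def by (rule Lim_transform_eventually)
qed

text \<open>
  The slice of a relatively open subset of the half-space through \<open>x\<close> contains a right-sided
  neighbourhood of \<open>x i\<close>: increasing a coordinate never leaves the half-space.  Hence the
  one-sided derivative is unique there, and it must be that of any extension \<open>g\<close> of \<open>f\<close>.
\<close>
lemma partial_deriv_half_space:
  assumes S: "openin (subtopology (Euclidean_space n) (half_space n)) S" and xS: "x \<in> S"
    and U: "openin (Euclidean_space n) U" and xU: "x \<in> U"
    and g: "Ck_open n (Suc 0) U g" and i: "i < n"
    and eq: "\<And>y. y \<in> S \<inter> U \<Longrightarrow> g y = f y"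
  shows "partial_deriv S i f x = partial_deriv U i g x"
proof -
  obtain W where W: "openin (Euclidean_space n) W" "S = W \<inter> half_space n"
    using S unfolding openin_subtopology by auto
  have "openin (Euclidean_space n) (W \<inter> U)" "x \<in> W \<inter> U" using W U xS xU by auto
  from openin_Euclidean_space_box[OF this] obtain r where r: "r > 0"
    "\<And>y. y \<in> topspace (Euclidean_space n) \<Longrightarrow> (\<And>i. i < n \<Longrightarrow> \<bar>y i - x i\<bar> < r) \<Longrightarrow> y \<in> W \<inter> U"
    by blast
  have upd: "x(i := h) \<in> topspace (Euclidean_space n)" for h
    using xU openin_subset[OF U] i by (auto simp: topspace_Euclidean_space)
  have near: "x(i := h) \<in> W \<inter> U" if "\<bar>h - x i\<bar> < r" for h
    using that r by (intro r(2)[OF upd]) auto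
  define B where "B = {h. x(i := h) \<in> S}"
  have hs: "x(i := h) \<in> half_space n" if "h \<ge> x i" for h
    using that upd[of h] xS W(2) by (auto simp: half_space_def)
  have "{x i..x i + r/2} \<subseteq> B"
    using near hs W(2) r(1) by (force simp: B_def)
  then have "at (x i) within {x i..x i + r/2} \<le> at (x i) within B"
    by (intro at_le)
  moreover have "at (x i) within {x i..x i + r/2} \<noteq> bot"
    using r(1) by (simp add: at_within_Icc_at_right trivial_limit_at_right_real)
  ultimately have nontriv: "at (x i) within B \<noteq> bot"
    using le_bot by metis
  have "((\<lambda>h. g (x(i := h))) has_real_derivative partial_deriv U i g x)
      (at (x i) within (B \<inter> ball (x i) r))"
    by (rule DERIV_subset[OF partial_deriv_works[OF g xU i]])
      (use near in \<open>auto simp: dist_real_def abs_minus_commute\<close>)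
  then have "((\<lambda>h. f (x(i := h))) has_real_derivative partial_deriv U i g x)
      (at (x i) within (B \<inter> ball (x i) r))"
    by (rule has_field_derivative_transform_within[of _ _ _ _ 1])
      (use near xS r(1) eq in \<open>auto simp: B_def dist_real_def abs_minus_commute\<close>)
  moreover have "at (x i) within (B \<inter> ball (x i) r) = at (x i) within B"
    using r(1) by (intro at_within_nhd[of _ "ball (x i) r"]) auto
  ultimately show ?thesis
    using nontriv unfolding partial_deriv_def[of S] B_def[symmetric]
    by (simp add: vector_derivative_within has_real_derivative_iff_has_vector_derivative)
qed

section \<open>Functions along integral curves\<close>

text \<open>
  An integral curve satisfies its differential equation in every chart, in particular in the
  chart \<open>\<kappa>\<close> that the definition of \<open>lie_deriv\<close> selects at \<open>c t\<close>.  In \<open>\<kappa>\<close>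
  the function coincides near \<open>c t\<close> with a \<open>C\<^sup>1\<close> function \<open>g\<close> on an open set, to which the
  chain rule applies.
\<close>
lemma has_derivative_along_integral_curve:
  assumes M: "smooth_manifold M" and V: "C1_function M V"
    and c: "integral_curve M X a b c" and t: "t \<in> {a..b}"
  shows "((\<lambda>u. V (c u)) has_real_derivative lie_deriv M X V (c t)) (at t within {a..b})"
proof -
  let ?n = "mdim M"
  have cont: "continuous_map (top_of_set {a..b}) (mtop M) c"
    using c by (simp add: integral_curve_def)
  have "c t \<in> carr M"
    using continuous_map_image_subset_topspace[OF cont] t by auto
  define \<kappa> where "\<kappa> = (SOME \<kappa>. \<kappa> \<in> atlas M \<and> c t \<in> fst \<kappa>)"
  have "\<exists>\<kappa>. \<kappa> \<in> atlas M \<and> c t \<in> fst \<kappa>"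
    using M \<open>c t \<in> carr M\<close> unfolding smooth_manifold_def by auto
  from someI_ex[OF this] have \<kappa>: "\<kappa> \<in> atlas M" "c t \<in> fst \<kappa>"
    unfolding \<kappa>_def by auto
  have chart: "is_chart (mtop M) ?n \<kappa>"
    using M \<kappa>(1) unfolding smooth_manifold_def by blast
  define S where "S = snd \<kappa> ` fst \<kappa>"
  define x where "x = snd \<kappa> (c t)"
  define f where "f = (\<lambda>y. V (chart_inv \<kappa> y))"
  have S: "openin (subtopology (Euclidean_space ?n) (half_space ?n)) S"
    and opn: "openin (mtop M) (fst \<kappa>)"
    and hom: "homeomorphic_map (subtopology (mtop M) (fst \<kappa>)) (subtopology (Euclidean_space ?n) S) (snd \<kappa>)"
    using chart by (auto simp: is_chart_def S_def)
  have S_top: "S \<subseteq> topspace (Euclidean_space ?n)"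
    using openin_subset[OF S] by auto
  have inj: "inj_on (snd \<kappa>) (fst \<kappa>)"
    using homeomorphic_imp_injective_map[OF hom] openin_subset[OF opn] by (simp add: Int_absorb1)
  have inv: "chart_inv \<kappa> (snd \<kappa> p) = p" if "p \<in> fst \<kappa>" for p
    unfolding chart_inv_def using inj that by simp
  have xS: "x \<in> S" using \<kappa>(2) by (simp add: x_def S_def)
  have "Ck_on ?n 1 S f"
    using V \<kappa>(1) unfolding C1_function_def S_def f_def by blast
  then have "\<exists>U g. openin (Euclidean_space ?n) U \<and> x \<in> U \<and>
      (\<forall>j. enat j \<le> 1 \<longrightarrow> Ck_open ?n j U g) \<and> (\<forall>y\<in>S \<inter> U. g y = f y)"
    unfolding Ck_on_def using xS by (rule bspec)
  then obtain U g where U: "openin (Euclidean_space ?n) U" "x \<in> U"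
      and g1: "\<forall>j. enat j \<le> 1 \<longrightarrow> Ck_open ?n j U g" and eq: "\<And>y. y \<in> S \<inter> U \<Longrightarrow> g y = f y"
    by (elim exE conjE) blast
  have g: "Ck_open ?n (Suc 0) U g"
    using g1 by (metis One_nat_def one_enat_def order_refl)
  have deriv: "((\<lambda>u. snd \<kappa> (c u) i) has_real_derivative X (c t) \<kappa> i) (at t within {a..b})"
    if "i < ?n" for i
    using c t \<kappa> that unfolding integral_curve_def by blast
  have in_chart: "\<forall>\<^sub>F u in at t within {a..b}. c u \<in> fst \<kappa> \<and> snd \<kappa> (c u) \<in> U"
  proof -
    define P where "P = {p \<in> topspace (subtopology (mtop M) (fst \<kappa>)). snd \<kappa> p \<in> S \<inter> U}"
    have "openin (subtopology (Euclidean_space ?n) S) (S \<inter> U)"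
      using U(1) by (auto simp: openin_subtopology)
    then have "openin (subtopology (mtop M) (fst \<kappa>)) P"
      unfolding P_def
      by (rule openin_continuous_map_preimage[OF homeomorphic_imp_continuous_map[OF hom]])
    then have "openin (mtop M) P" using opn by (simp add: openin_open_subtopology)
    then have "openin (top_of_set {a..b}) {u \<in> topspace (top_of_set {a..b}). c u \<in> P}"
      by (rule openin_continuous_map_preimage[OF cont])
    then obtain T where T: "open T" "{u \<in> {a..b}. c u \<in> P} = {a..b} \<inter> T"
      by (auto simp: openin_open)
    have "c t \<in> P" using \<kappa>(2) \<open>c t \<in> carr M\<close> xS U(2) by (simp add: P_def x_def)
    then have "t \<in> T" using T(2) t by blast
    have "\<forall>\<^sub>F u in at t within {a..b}. u \<in> T"
      using T(1) \<open>t \<in> T\<close> by (metis eventually_at_topological)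
    moreover have "\<forall>\<^sub>F u in at t within {a..b}. u \<in> {a..b}"
      by (simp add: eventually_at_filter)
    ultimately show ?thesis
      by eventually_elim (use T(2) in \<open>auto simp: P_def set_eq_iff\<close>)
  qed
  have top: "\<forall>\<^sub>F u in at t within {a..b}. snd \<kappa> (c u) \<in> topspace (Euclidean_space ?n)"
    using in_chart by eventually_elim (use S_top in \<open>auto simp: S_def\<close>)
  have "((\<lambda>u. g (snd \<kappa> (c u))) has_real_derivative
      (\<Sum>i<?n. partial_deriv U i g (snd \<kappa> (c t)) * X (c t) \<kappa> i)) (at t within {a..b})"
    using chain_rule_Ck_open[OF U(1) g, of "\<lambda>u. snd \<kappa> (c u)", OF _ top deriv] U(2)
    by (simp add: x_def)
  also have "(\<Sum>i<?n. partial_deriv U i g (snd \<kappa> (c t)) * X (c t) \<kappa> i) = lie_deriv M X V (c t)"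
    unfolding lie_deriv_def Let_def \<kappa>_def[symmetric]
    using partial_deriv_half_space[OF S xS U g _ eq] by (simp add: x_def S_def f_def)
  finally have *: "((\<lambda>u. g (snd \<kappa> (c u))) has_real_derivative lie_deriv M X V (c t))
      (at t within {a..b})" .
  have agree: "g (snd \<kappa> p) = V p" if "p \<in> fst \<kappa>" "snd \<kappa> p \<in> U" for p
    using eq[of "snd \<kappa> p"] that inv by (simp add: S_def f_def)
  have "\<forall>\<^sub>F u in at t within {a..b}. V (c u) = g (snd \<kappa> (c u))"
    using in_chart by eventually_elim (simp add: agree)
  moreover have "V (c t) = g (snd \<kappa> (c t))"
    using agree \<kappa>(2) U(2) by (simp add: x_def)
  ultimately show ?thesis
    using * by (simp add: has_field_derivative_cong_eventually)
qed

lemma nonincreasing_along_integral_curve: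
  assumes M: "smooth_manifold M" and V: "C1_function M V"
    and c: "integral_curve M X a b c"
    and decr: "\<And>x. x \<in> carr M \<Longrightarrow> lie_deriv M X V x \<le> 0"
    and t: "t \<in> {a..b}"
  shows "V (c t) \<le> V (c a)"
proof (cases "t = a")
  case False
  then have "a < t" using t by simp
  have "((\<lambda>u. V (c u)) has_derivative (*) (lie_deriv M X V (c u))) (at u within {a..t})"
    if "u \<in> {a..t}" for u
  proof -
    have "((\<lambda>u. V (c u)) has_real_derivative lie_deriv M X V (c u)) (at u within {a..t})"
      using t that by (intro DERIV_subset[OF has_derivative_along_integral_curve[OF M V c]]) auto
    then show ?thesis by (simp add: has_field_derivative_def)
  qed
  from mvt_simple[OF \<open>a < t\<close> this] obtain u where u: "u \<in> {a<..<t}"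
    "V (c t) - V (c a) = lie_deriv M X V (c u) * (t - a)" by auto
  have "continuous_map (top_of_set {a..b}) (mtop M) c"
    using c by (simp add: integral_curve_def)
  from continuous_map_image_subset_topspace[OF this] have "c u \<in> carr M"
    using u(1) t by auto
  then have "lie_deriv M X V (c u) * (t - a) \<le> 0"
    using decr \<open>a < t\<close> by (intro mult_nonpos_nonneg) auto
  then show ?thesis using u(2) by simp
qed simp

section \<open>Stability\<close>

lemma state_in_points:
  assumes "execution H \<xi>" "j \<in> idx \<xi>" "t \<in> ival \<xi> j"
  shows "state \<xi> j t \<in> points H"
proof -
  have v: "rho \<xi> j \<in> hverts H" and
    "continuous_map (top_of_set (ival \<xi> j)) (mtop (hdom H (rho \<xi> j))) (traj \<xi> j)"
    using assms(1,2) unfolding execution_def integral_curve_def by auto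
  from continuous_map_image_subset_topspace[OF this(2)]
  have "traj \<xi> j t \<in> carr (hdom H (rho \<xi> j))" using assms(3) by auto
  with v show ?thesis by (simp add: points_def state_def)
qed

lemma start_in_points:
  assumes "execution H \<xi>"
  shows "start \<xi> \<in> points H"
  using assms unfolding execution_def by (intro state_in_points[OF assms]) auto

theorem corollary31:
  fixes H :: "('v, 'e, 'p) hybrid_data"
    and d :: "'v \<times> 'p \<Rightarrow> 'v \<times> 'p \<Rightarrow> real"
    and z :: "'v \<times> 'p"
    and c l :: real
    and a1 b1 a2 b2 :: "real \<Rightarrow> real"
    and Vc Vd :: "'v \<times> 'p \<Rightarrow> real"
  assumes "hybrid_system H"
    and "semi_metric_on (points H) d"
    and "z \<in> points H" and "forward_invariant H z"
    and "c > 0" and "0 < l" and "l < 1"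
    and "class_K a1" and "class_K b1" and "class_K a2" and "class_K b2"
    and "\<forall>x\<in>points H. 0 \<le> Vc x \<and> 0 \<le> Vd x"
    and "\<forall>v\<in>hverts H. C1_function (hdom H v) (\<lambda>x. Vc (v, x))"
    and "\<forall>x\<in>points H. a1 (d x z) \<le> Vc x \<and> Vc x \<le> b1 (d x z)"
    and "\<forall>x\<in>points H. a2 (d x z) \<le> Vd x \<and> Vd x \<le> b2 (d x z)"
    and "\<forall>v\<in>hverts H. \<forall>x\<in>carr (hdom H v).
           lie_deriv (hdom H v) (hfield H v) (\<lambda>x. Vc (v, x)) x \<le> - c"
    and "\<forall>e\<in>hedges H. \<forall>x\<in>guard H e.
           Vc (src H e, x) = 0 \<and>
           Vd (tgt H e, reset H e x) \<le> l * Vd (src H e, x) \<and>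
           Vc (tgt H e, reset H e x) \<le> Vd (src H e, x)"
  shows "stable_point H d z"
proof -
  have z0: "d z z = 0" and d0: "\<And>x. x \<in> points H \<Longrightarrow> 0 \<le> d x z"
    and deq: "\<And>x. x \<in> points H \<Longrightarrow> d x z = 0 \<Longrightarrow> x = z"
    using assms(2,3) unfolding semi_metric_on_def by auto
  have Vd_z: "Vd z \<le> 0"
    using assms(3,11,15) z0 unfolding class_K_def by force
  have bound: "Vc (state \<xi> j t) \<le> Vc (start \<xi>)"
    if \<xi>: "execution H \<xi>" and j: "j \<in> idx \<xi>" and t: "t \<in> ival \<xi> j" for \<xi> j t
  proof -
    have flow: "Vc (state \<xi> j t) \<le> Vc (state \<xi> j (tau \<xi> j))"
      if j: "j \<in> idx \<xi>" and t: "t \<in> ival \<xi> j" for j t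
    proof -
      have v: "rho \<xi> j \<in> hverts H" and curve: "integral_curve (hdom H (rho \<xi> j))
          (hfield H (rho \<xi> j)) (tau \<xi> j) (tau \<xi> (Suc j)) (traj \<xi> j)"
        using \<xi> j unfolding execution_def by auto
      have M: "smooth_manifold (hdom H (rho \<xi> j))"
        using assms(1) v by (simp add: hybrid_system_def)
      have "lie_deriv (hdom H (rho \<xi> j)) (hfield H (rho \<xi> j)) (\<lambda>x. Vc (rho \<xi> j, x)) x \<le> 0"
        if "x \<in> carr (hdom H (rho \<xi> j))" for x
        using bspec[OF bspec[OF assms(16) v] that] assms(5) by linarith
      from nonincreasing_along_integral_curve[OF M _ curve this t] show ?thesis
        using assms(13) v by (simp add: state_def)
    qed
    (* Every trajectory but the first starts with a reset of z, so Vc vanishes at its initial point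
       whatever happened before. *)
    have entry: "Vc (state \<xi> j (tau \<xi> j)) \<le> Vc (start \<xi>)"
    proof (cases j)
      case (Suc i)
      have i: "i \<in> idx \<xi>" using j Suc \<xi> unfolding execution_def by auto
      let ?s = "tau \<xi> (Suc i)"
      have "tau \<xi> i \<le> ?s" using \<xi> i unfolding execution_def by auto
      then have pts: "state \<xi> i ?s \<in> points H" by (intro state_in_points[OF \<xi> i]) auto
      obtain e where e: "e \<in> hedges H" "src H e = rho \<xi> i" "tgt H e = rho \<xi> (Suc i)"
          "traj \<xi> i ?s \<in> guard H e" "traj \<xi> (Suc i) ?s = reset H e (traj \<xi> i ?s)"
        using \<xi> i j Suc unfolding execution_def by blast
      have jump: "Vc (state \<xi> i ?s) = 0" "Vc (state \<xi> (Suc i) ?s) \<le> Vd (state \<xi> i ?s)"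
        using assms(17) e unfolding state_def by metis+
      have "a1 (d (state \<xi> i ?s) z) \<le> 0"
        using assms(14) pts jump(1) by metis
      then have "state \<xi> i ?s = z"
        using deq[OF pts] class_K_nonpos_imp_zero[OF assms(8) d0[OF pts]] by blast
      then have "Vc (state \<xi> (Suc i) ?s) \<le> 0" using jump(2) Vd_z by simp
      moreover have "0 \<le> Vc (start \<xi>)" using assms(12) start_in_points[OF \<xi>] by blast
      ultimately show ?thesis using Suc by simp
    qed simp
    show ?thesis using flow[OF j t] entry by (rule order_trans)
  qed
  obtain a1' where a1': "class_K a1'" "\<And>x. x \<ge> 0 \<Longrightarrow> a1' (a1 x) = x"
    using class_K_inverse[OF assms(8)] by blast
  have "d (state \<xi> j t) z \<le> a1' (b1 (d (start \<xi>) z))"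
    if \<xi>: "execution H \<xi>" and j: "j \<in> idx \<xi>" and t: "t \<in> ival \<xi> j" for \<xi> j t
  proof -
    have pt: "state \<xi> j t \<in> points H" using state_in_points[OF \<xi> j t] .
    have start: "start \<xi> \<in> points H" using start_in_points[OF \<xi>] .
    have "a1 (d (state \<xi> j t) z) \<le> Vc (state \<xi> j t)" using assms(14) pt by blast
    also have "\<dots> \<le> Vc (start \<xi>)" using bound[OF \<xi> j t] .
    also have "\<dots> \<le> b1 (d (start \<xi>) z)" using assms(14) start by blast
    finally have "a1 (d (state \<xi> j t) z) \<le> b1 (d (start \<xi>) z)" .
    moreover have "0 \<le> a1 (d (state \<xi> j t) z)"
      using assms(8) d0[OF pt] unfolding class_K_def by auto
    ultimately have "a1' (a1 (d (state \<xi> j t) z)) \<le> a1' (b1 (d (start \<xi>) z))"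
      by (intro class_K_mono[OF a1'(1)])
    then show ?thesis using a1'(2)[OF d0[OF pt]] by simp
  qed
  then show ?thesis
    unfolding stable_point_def using class_K_compose[OF a1'(1) assms(9)] by blast
qed

end
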